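(* Let $G$ be a topologized group whose topology is semiregular. Assume that one of the following conditions holds: (1) $G$ is a $\Delta$-Baire paratopological group; (2) $G$ is a $\Delta_h$-Baire quasitopological group. Then $G$ is a topological group.
   Context: A topologized group is a group equipped with a topology (no compatibility assumed). It is semitopological if all left and right translations $x\mapsto gx$, $x\mapsto xg$ are continuous; paratopological if multiplication $G\times G\to G$ is continuous; quasitopological if it is semitopological and inversion $x\mapsto x^{-1}$ is continuous; topological if multiplication and inversion are continuous. A space is semiregular if it has a base consisting of regular open sets, i.e. sets $U$ with $U=\operatorname{Int}\overline U$. For $P\subset X\times X$ let $P(x)=\{y:(x,y)\in P\}$. $P$ is a semi-neighborhood of the diagonal of a space $X$ if $x\in\operatorname{Int}P(x)$ for all $x\in X$. A space $X$ is $\Delta$-Baire (respectively $\Delta_h$-Baire) if for every semi-neighborhood of the diagonal $P$ and every nonempty open $O\subset X$ there is a nonempty open $W\subset O$ such that $P\cap(W\times W)$ is dense in $W\times W$ (respectively: for every $y\in W$ the set $\{x\in W:(x,y)\in P\}$ is dense in $W$). *)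

theory Defs
  imports "HOL-Analysis.Analysis" "HOL-Algebra.Group"
begin

(* Spaces are abstract topologies, so that the group and its topology share the carrier set
   and no separation axiom is built in. *)

definition regular_open :: "'a topology \<Rightarrow> 'a set \<Rightarrow> bool" where
  "regular_open X U \<longleftrightarrow> U = X interior_of (X closure_of U)"

(* arbitrary union_of B = openin X says that B is a base of X. *)
definition semiregular_space :: "'a topology \<Rightarrow> bool" where
  "semiregular_space X \<longleftrightarrow>
     (\<exists>\<B>. (\<forall>U\<in>\<B>. regular_open X U) \<and> arbitrary union_of (\<lambda>U. U \<in> \<B>) = openin X)"

definition dense_in :: "'a topology \<Rightarrow> 'a set \<Rightarrow> 'a set \<Rightarrow> bool" where
  "dense_in X D S \<longleftrightarrow> D \<subseteq> S \<and> S \<subseteq> X closure_of D"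

definition semi_neighborhood_diag :: "'a topology \<Rightarrow> ('a \<times> 'a) set \<Rightarrow> bool" where
  "semi_neighborhood_diag X P \<longleftrightarrow>
     P \<subseteq> topspace X \<times> topspace X \<and> (\<forall>x\<in>topspace X. x \<in> X interior_of (P `` {x}))"

definition Delta_Baire :: "'a topology \<Rightarrow> bool" where
  "Delta_Baire X \<longleftrightarrow>
     (\<forall>P V. semi_neighborhood_diag X P \<and> openin X V \<and> V \<noteq> {} \<longrightarrow>
        (\<exists>W. openin X W \<and> W \<noteq> {} \<and> W \<subseteq> V \<and>
             dense_in (prod_topology X X) (P \<inter> W \<times> W) (W \<times> W)))"

definition Delta_h_Baire :: "'a topology \<Rightarrow> bool" where
  "Delta_h_Baire X \<longleftrightarrow>
     (\<forall>P V. semi_neighborhood_diag X P \<and> openin X V \<and> V \<noteq> {} \<longrightarrow>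
        (\<exists>W. openin X W \<and> W \<noteq> {} \<and> W \<subseteq> V \<and>
             (\<forall>y\<in>W. dense_in X {x \<in> W. (x, y) \<in> P} W)))"

locale topologized_group = group G
  for G :: "('a, 'b) monoid_scheme" (structure) +
  fixes T :: "'a topology"
  assumes topspace_eq_carrier: "topspace T = carrier G"

locale semitopological_group = topologized_group +
  assumes continuous_left_translation:
      "g \<in> carrier G \<Longrightarrow> continuous_map T T (\<lambda>x. g \<otimes> x)"
    and continuous_right_translation:
      "g \<in> carrier G \<Longrightarrow> continuous_map T T (\<lambda>x. x \<otimes> g)"

locale paratopological_group = topologized_group +
  assumes continuous_mult: "continuous_map (prod_topology T T) T (\<lambda>(x, y). x \<otimes> y)"

locale quasitopological_group = semitopological_group +
  assumes continuous_inv: "continuous_map T T (\<lambda>x. inv x)"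

locale topological_group = topologized_group +
  assumes continuous_mult: "continuous_map (prod_topology T T) T (\<lambda>(x, y). x \<otimes> y)"
    and continuous_inv: "continuous_map T T (\<lambda>x. inv x)"

end

theory Submission
  imports Defs
begin

text \<open>
  Both cases rest on one criterion: a semitopological group is a topological group as soon as it
  has \<^emph>\<open>small\<close> nonempty open sets, that is, every open \<open>V \<ni> \<one>\<close> admits a nonempty open \<open>W\<close> with
  \<open>W\<inverse> W \<subseteq> V\<close> (lemma \<open>topological_group_if_small_open_sets\<close>).

  Semiregularity reduces the search for \<open>W\<close> to a density statement. Let \<open>B \<subseteq> V\<close> be a regular open
  neighbourhood of \<open>\<one>\<close>. If \<open>W \<subseteq> cl (x B)\<close> for every \<open>x \<in> W\<close>, then \<open>x\<inverse> W\<close> is an open subset of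
  \<open>cl B\<close>, hence of \<open>Int (cl B) = B\<close>, and so \<open>W\<inverse> W \<subseteq> B\<close>.

  The Baire type hypotheses produce such a \<open>W\<close> when applied to a left invariant relation.
  \<^item> In a paratopological group take \<open>U \<ni> \<one>\<close> open with \<open>U U \<subseteq> B\<close> and \<open>P = {(x, y). y \<in> x U}\<close>. If
    \<open>P\<close> is dense in \<open>W \<times> W\<close>, then arbitrarily near \<open>y \<in> W\<close> there is \<open>y'\<close> with \<open>y' \<in> x' U\<close> for some
    \<open>x' \<in> x U\<close>, so \<open>y' \<in> x U U \<subseteq> x B\<close>. Density in the product moves both coordinates; continuity
    of multiplication absorbs the movement of \<open>x\<close>.
  \<^item> In a quasitopological group take \<open>P = {(x, y). x \<in> y B}\<close>, whose sections \<open>P(x) = x B\<inverse>\<close> are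
    open because inversion is continuous. Density of \<open>{x \<in> W. (x, y) \<in> P}\<close> in \<open>W\<close> gives
    \<open>W \<subseteq> cl (y B)\<close> directly.
\<close>

lemma semiregular_spaceE:
  assumes "semiregular_space X" "openin X V" "a \<in> V"
  obtains B where "openin X B" "regular_open X B" "a \<in> B" "B \<subseteq> V"
proof -
  obtain \<B> where reg: "\<forall>U\<in>\<B>. regular_open X U"
    and base: "arbitrary union_of (\<lambda>U. U \<in> \<B>) = openin X"
    using assms(1) unfolding semiregular_space_def by blast
  have "(arbitrary union_of (\<lambda>U. U \<in> \<B>)) V"
    using assms(2) base by simp
  then obtain \<U> where "\<U> \<subseteq> \<B>" "\<Union>\<U> = V"
    unfolding union_of_def by blast
  then obtain B where B: "B \<in> \<B>" "a \<in> B" "B \<subseteq> V"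
    using assms(3) by blast
  moreover have "regular_open X B"
    using reg B(1) by blast
  moreover from this have "openin X B"
    unfolding regular_open_def by (metis openin_interior_of)
  ultimately show thesis
    using that by blast
qed

context semitopological_group
begin

lemma open_subset_carrier: "openin T S \<Longrightarrow> S \<subseteq> carrier G"
  using openin_subset topspace_eq_carrier by blast

lemma openin_left_preimage:
  assumes "openin T S" "g \<in> carrier G"
  shows "openin T {x \<in> carrier G. g \<otimes> x \<in> S}"
  using openin_continuous_map_preimage[OF continuous_left_translation[OF assms(2)] assms(1)]
  by (simp add: topspace_eq_carrier)

lemma openin_right_preimage:
  assumes "openin T S" "g \<in> carrier G"
  shows "openin T {x \<in> carrier G. x \<otimes> g \<in> S}"
  using openin_continuous_map_preimage[OF continuous_right_translation[OF assms(2)] assms(1)]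
  by (simp add: topspace_eq_carrier)

lemma homeomorphic_map_left_translation:
  assumes "g \<in> carrier G"
  shows "homeomorphic_map T T (\<lambda>x. g \<otimes> x)"
proof -
  have "homeomorphic_maps T T (\<lambda>x. g \<otimes> x) (\<lambda>x. inv g \<otimes> x)"
    unfolding homeomorphic_maps_def
    using assms continuous_left_translation
    by (simp add: topspace_eq_carrier m_assoc[symmetric])
  then show ?thesis
    using homeomorphic_map_maps by blast
qed

text \<open>
  Translating by \<open>x\<inverse>\<close> turns the hypothesis into \<open>x\<inverse> W \<subseteq> cl B\<close>. This set is open, so it lies in the
  interior of \<open>cl B\<close>, and regularity of \<open>B\<close> removes the closure.
\<close>
lemma quotient_in_regular_open:
  assumes W: "openin T W" and B: "openin T B" "regular_open T B"
    and x: "x \<in> W" and y: "y \<in> W"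
    and cl: "W \<subseteq> T closure_of ((\<lambda>z. x \<otimes> z) ` B)"
  shows "inv x \<otimes> y \<in> B"
proof -
  have xG: "x \<in> carrier G" and yG: "y \<in> carrier G"
    using open_subset_carrier[OF W] x y by auto
  have "T closure_of ((\<lambda>z. x \<otimes> z) ` B) = (\<lambda>z. x \<otimes> z) ` (T closure_of B)"
    using homeomorphic_map_closure_of[OF homeomorphic_map_left_translation[OF xG] openin_subset[OF B(1)]] .
  with cl have W_cl: "W \<subseteq> (\<lambda>z. x \<otimes> z) ` (T closure_of B)"
    by simp
  have "{z \<in> carrier G. x \<otimes> z \<in> W} \<subseteq> T closure_of B"
  proof clarify
    fix z assume z: "z \<in> carrier G" "x \<otimes> z \<in> W"
    then obtain b where b: "b \<in> T closure_of B" "x \<otimes> z = x \<otimes> b"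
      using W_cl by blast
    then have "b \<in> carrier G"
      using closure_of_subset_topspace[of T B] topspace_eq_carrier by blast
    then show "z \<in> T closure_of B"
      using b z xG by simp
  qed
  then have "{z \<in> carrier G. x \<otimes> z \<in> W} \<subseteq> T interior_of (T closure_of B)"
    using openin_left_preimage[OF W xG] by (rule interior_of_maximal)
  moreover have "inv x \<otimes> y \<in> {z \<in> carrier G. x \<otimes> z \<in> W}"
    using xG yG y by (simp add: m_assoc[symmetric])
  ultimately show ?thesis
    using B(2) unfolding regular_open_def by blast
qed

text \<open>
  With \<open>w \<in> W\<close>, an identity written as a quotient \<open>a\<inverse> b\<close> of two points near \<open>w\<close> gives continuity:
  \<open>x\<inverse> g = (w g\<inverse> x)\<inverse> w\<close> handles inversion at \<open>g\<close>, and
  \<open>g\<inverse> x y h\<inverse> = (w x\<inverse> g)\<inverse> (w y h\<inverse>)\<close> handles multiplication at \<open>(g, h)\<close>. The second identity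
  contains \<open>x\<inverse>\<close>, which is why inversion comes first.
\<close>
lemma topological_group_if_small_open_sets:
  assumes small: "\<And>V. openin T V \<Longrightarrow> \<one> \<in> V \<Longrightarrow>
    \<exists>W. openin T W \<and> W \<noteq> {} \<and> (\<forall>x\<in>W. \<forall>y\<in>W. inv x \<otimes> y \<in> V)"
  shows "topological_group G T"
proof -
  have cont_inv: "continuous_map T T (\<lambda>x. inv x)"
  proof -
    have "openin T {x \<in> carrier G. inv x \<in> U}" if U: "openin T U" for U
    proof (subst openin_subopen, clarify)
      fix g assume g: "g \<in> carrier G" "inv g \<in> U"
      have "openin T {z \<in> carrier G. z \<otimes> inv g \<in> U}"
        using openin_right_preimage[OF U] g by simp
      from small[OF this] g obtain W where W: "openin T W" "W \<noteq> {}"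
        "\<And>x y. \<lbrakk>x \<in> W; y \<in> W\<rbrakk> \<Longrightarrow> (inv x \<otimes> y) \<otimes> inv g \<in> U"
        by auto
      then obtain w where w: "w \<in> W" by blast
      then have wG: "w \<in> carrier G" using open_subset_carrier[OF W(1)] by blast
      let ?N = "{x \<in> carrier G. (w \<otimes> inv g) \<otimes> x \<in> W}"
      have "?N \<subseteq> {x \<in> carrier G. inv x \<in> U}"
      proof clarify
        fix x assume x: "x \<in> carrier G" "(w \<otimes> inv g) \<otimes> x \<in> W"
        have "inv ((w \<otimes> inv g) \<otimes> x) \<otimes> w = inv x \<otimes> (g \<otimes> (inv w \<otimes> w))"
          using x g wG by (simp add: inv_mult_group m_assoc del: l_inv)
        then have "inv ((w \<otimes> inv g) \<otimes> x) \<otimes> w \<otimes> inv g = inv x"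
          using x g wG by (simp add: m_assoc)
        then show "inv x \<in> U" using W(3)[OF x(2) w] by simp
      qed
      moreover have "g \<in> ?N"
        using g w wG by (simp add: m_assoc)
      moreover have "openin T ?N"
        using openin_left_preimage[OF W(1)] g wG by simp
      ultimately show "\<exists>N. openin T N \<and> g \<in> N \<and> N \<subseteq> {x \<in> carrier G. inv x \<in> U}"
        by blast
    qed
    then show ?thesis
      by (simp add: continuous_map_def topspace_eq_carrier)
  qed
  have cont_mult: "continuous_map (prod_topology T T) T (\<lambda>(x, y). x \<otimes> y)"
  proof -
    have "openin (prod_topology T T) {p \<in> carrier G \<times> carrier G. (case p of (x, y) \<Rightarrow> x \<otimes> y) \<in> U}"
      (is "openin _ ?M") if U: "openin T U" for U
      unfolding openin_prod_topology_alt
    proof (intro allI impI)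
      fix g h assume "(g, h) \<in> ?M"
      then have gh: "g \<in> carrier G" "h \<in> carrier G" "g \<otimes> h \<in> U" by auto
      have "openin T {z \<in> carrier G. z \<otimes> h \<in> U}"
        using openin_right_preimage[OF U gh(2)] .
      from openin_left_preimage[OF this gh(1)]
      have "openin T {z \<in> carrier G. g \<otimes> z \<otimes> h \<in> U}"
        by (rule back_subst) (use gh in auto)
      from small[OF this] gh obtain W where W: "openin T W" "W \<noteq> {}"
        "\<And>x y. \<lbrakk>x \<in> W; y \<in> W\<rbrakk> \<Longrightarrow> g \<otimes> (inv x \<otimes> y) \<otimes> h \<in> U"
        by auto
      then obtain w where w: "w \<in> W" by blast
      then have wG: "w \<in> carrier G" using open_subset_carrier[OF W(1)] by blast
      let ?A = "{x \<in> carrier G. w \<otimes> (inv x \<otimes> g) \<in> W}"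
      let ?B = "{y \<in> carrier G. w \<otimes> (y \<otimes> inv h) \<in> W}"
      have 1: "openin T {z \<in> carrier G. w \<otimes> z \<in> W}"
        using openin_left_preimage[OF W(1) wG] .
      from openin_right_preimage[OF this inv_closed[OF gh(2)]]
      have B: "openin T ?B"
        by (rule back_subst) (use gh in auto)
      from openin_continuous_map_preimage[OF cont_inv openin_right_preimage[OF 1 gh(1)]]
      have A: "openin T ?A"
        by (rule back_subst) (use gh in \<open>auto simp: topspace_eq_carrier\<close>)
      have "g \<in> ?A" "h \<in> ?B"
        using gh w wG by auto
      moreover have "?A \<times> ?B \<subseteq> ?M"
      proof (rule subrelI)
        fix x y assume "(x, y) \<in> ?A \<times> ?B"
        then have xy: "x \<in> carrier G" "y \<in> carrier G"
          "w \<otimes> (inv x \<otimes> g) \<in> W" "w \<otimes> (y \<otimes> inv h) \<in> W"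
          by auto
        have "inv (w \<otimes> (inv x \<otimes> g)) \<otimes> (w \<otimes> (y \<otimes> inv h))
            = inv g \<otimes> (x \<otimes> (inv w \<otimes> (w \<otimes> (y \<otimes> inv h))))"
          using xy gh wG by (simp add: inv_mult_group m_assoc)
        also have "\<dots> = inv g \<otimes> (x \<otimes> (y \<otimes> inv h))"
          using xy gh wG by (simp add: m_assoc[symmetric])
        finally have eq: "inv (w \<otimes> (inv x \<otimes> g)) \<otimes> (w \<otimes> (y \<otimes> inv h))
            = inv g \<otimes> (x \<otimes> (y \<otimes> inv h))" .
        have "g \<otimes> (inv g \<otimes> (x \<otimes> (y \<otimes> inv h))) = x \<otimes> (y \<otimes> inv h)"
          using xy gh by (simp add: m_assoc[symmetric])
        then have "g \<otimes> (inv g \<otimes> (x \<otimes> (y \<otimes> inv h))) \<otimes> h = x \<otimes> y"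
          using xy gh by (simp add: m_assoc)
        then have "x \<otimes> y \<in> U"
          using W(3)[OF xy(3,4)] unfolding eq by simp
        then show "(x, y) \<in> ?M"
          using xy by simp
      qed
      ultimately show "\<exists>A B. openin T A \<and> openin T B \<and> g \<in> A \<and> h \<in> B \<and> A \<times> B \<subseteq> ?M"
        using A B by blast
    qed
    then show ?thesis
      by (auto simp: continuous_map_def topspace_eq_carrier)
  qed
  show ?thesis
    using cont_mult cont_inv by unfold_locales
qed

text \<open>
  The common target of the two Baire type hypotheses: each only controls closures, and it is
  here that semiregularity is spent, by choosing \<open>B\<close> regular open.
\<close>
lemma topological_group_if_dense_in_translates:
  assumes "semiregular_space T"
    and dense: "\<And>B. openin T B \<Longrightarrow> \<one> \<in> B \<Longrightarrow>
      \<exists>W. openin T W \<and> W \<noteq> {} \<and> (\<forall>x\<in>W. W \<subseteq> T closure_of ((\<lambda>z. x \<otimes> z) ` B))"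
  shows "topological_group G T"
proof (rule topological_group_if_small_open_sets)
  fix V assume V: "openin T V" "\<one> \<in> V"
  obtain B where B: "openin T B" "regular_open T B" "\<one> \<in> B" "B \<subseteq> V"
    using semiregular_spaceE[OF assms(1) V] .
  obtain W where "openin T W" "W \<noteq> {}"
    "\<forall>x\<in>W. W \<subseteq> T closure_of ((\<lambda>z. x \<otimes> z) ` B)"
    using dense[OF B(1,3)] by blast
  moreover from this have "inv x \<otimes> y \<in> V" if "x \<in> W" "y \<in> W" for x y
    using quotient_in_regular_open[OF _ B(1,2) that] that(1) B(4) by auto
  ultimately show "\<exists>W. openin T W \<and> W \<noteq> {} \<and> (\<forall>x\<in>W. \<forall>y\<in>W. inv x \<otimes> y \<in> V)"
    by (intro exI[of _ W]) simp
qed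

end

lemma (in paratopological_group) semitopological: "semitopological_group G T"
proof unfold_locales
  fix g assume g: "g \<in> carrier G"
  have "continuous_map T (prod_topology T T) (\<lambda>x. (g, x))"
       "continuous_map T (prod_topology T T) (\<lambda>x. (x, g))"
    using g by (simp_all add: continuous_map_pairwise o_def topspace_eq_carrier)
  from this[THEN continuous_map_compose, OF continuous_mult]
  show "continuous_map T T (\<lambda>x. g \<otimes> x)" "continuous_map T T (\<lambda>x. x \<otimes> g)"
    by (simp_all add: o_def)
qed

text \<open>
  A point \<open>(x', y') \<in> P\<close> close to \<open>(x, y)\<close> satisfies \<open>x\<inverse> y' = (x\<inverse> x') (x'\<inverse> y')\<close> with both factors in
  \<open>U\<close>, as the neighbourhood of \<open>x\<close> can be taken to be \<open>x U\<close>. The neighbourhood of \<open>y\<close> stays arbitrary,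
  so \<open>y\<close> lies in the closure of \<open>x B\<close>.
\<close>
lemma (in paratopological_group) dense_in_translates_if_Delta_Baire:
  assumes "Delta_Baire T" and B: "openin T B" "\<one> \<in> B"
  shows "\<exists>W. openin T W \<and> W \<noteq> {} \<and> (\<forall>x\<in>W. W \<subseteq> T closure_of ((\<lambda>z. x \<otimes> z) ` B))"
proof -
  interpret semitopological_group G T by (rule semitopological)
  obtain U where U: "openin T U" "\<one> \<in> U" and UU: "\<And>u v. \<lbrakk>u \<in> U; v \<in> U\<rbrakk> \<Longrightarrow> u \<otimes> v \<in> B"
  proof -
    have "openin (prod_topology T T)
        {p \<in> topspace (prod_topology T T). (case p of (x, y) \<Rightarrow> x \<otimes> y) \<in> B}"
      using openin_continuous_map_preimage[OF continuous_mult B(1)] .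
    moreover have "(\<one>, \<one>) \<in> {p \<in> topspace (prod_topology T T). (case p of (x, y) \<Rightarrow> x \<otimes> y) \<in> B}"
      using B by (simp add: topspace_eq_carrier)
    ultimately obtain U1 U2 where "openin T U1" "openin T U2" "\<one> \<in> U1" "\<one> \<in> U2"
      "U1 \<times> U2 \<subseteq> {p \<in> topspace (prod_topology T T). (case p of (x, y) \<Rightarrow> x \<otimes> y) \<in> B}"
      unfolding openin_prod_topology_alt by meson
    then show thesis
      by (intro that[of "U1 \<inter> U2"]) auto
  qed
  define P where "P = {(x, y). x \<in> carrier G \<and> y \<in> carrier G \<and> inv x \<otimes> y \<in> U}"
  have "semi_neighborhood_diag T P"
    unfolding semi_neighborhood_diag_def
  proof (intro conjI ballI)
    show "P \<subseteq> topspace T \<times> topspace T" by (auto simp: P_def topspace_eq_carrier)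
    fix x assume "x \<in> topspace T"
    then have x: "x \<in> carrier G" by (simp add: topspace_eq_carrier)
    have P_section: "P `` {x} = {y \<in> carrier G. inv x \<otimes> y \<in> U}"
      using x by (auto simp: P_def)
    have "openin T (P `` {x})"
      unfolding P_section using openin_left_preimage[OF U(1)] x by simp
    then show "x \<in> T interior_of (P `` {x})"
      using x U(2) by (simp add: interior_of_openin P_section)
  qed
  moreover have "openin T (topspace T)" "topspace T \<noteq> {}"
    using one_closed unfolding topspace_eq_carrier[symmetric] by auto
  ultimately obtain W where W: "openin T W" "W \<noteq> {}"
    and dense: "W \<times> W \<subseteq> prod_topology T T closure_of (P \<inter> W \<times> W)"
    using assms(1) unfolding Delta_Baire_def dense_in_def by meson
  have "W \<subseteq> T closure_of ((\<lambda>z. x \<otimes> z) ` B)" if x: "x \<in> W" for x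
  proof
    fix y assume y: "y \<in> W"
    have xG: "x \<in> carrier G" and yG: "y \<in> carrier G"
      using x y open_subset_carrier[OF W(1)] by auto
    let ?xU = "{x' \<in> carrier G. inv x \<otimes> x' \<in> U}"
    have xU: "openin T ?xU"
      using openin_left_preimage[OF U(1)] xG by simp
    show "y \<in> T closure_of ((\<lambda>z. x \<otimes> z) ` B)"
      unfolding in_closure_of
    proof (intro conjI allI impI)
      show "y \<in> topspace T" using yG topspace_eq_carrier by simp
      fix Q assume Q: "y \<in> Q \<and> openin T Q"
      have "openin (prod_topology T T) (?xU \<times> Q)"
        using xU Q by (simp add: openin_prod_Times_iff)
      moreover have "(x, y) \<in> ?xU \<times> Q"
        using Q xG U(2) by simp
      moreover have "(x, y) \<in> prod_topology T T closure_of (P \<inter> W \<times> W)"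
        using dense x y by blast
      ultimately obtain p where "p \<in> P \<inter> W \<times> W" "p \<in> ?xU \<times> Q"
        unfolding in_closure_of by meson
      then obtain x' y' where *: "(x', y') \<in> P" "x' \<in> ?xU" "y' \<in> Q"
        by (cases p) auto
      then have G': "x' \<in> carrier G" "y' \<in> carrier G" "inv x' \<otimes> y' \<in> U" "inv x \<otimes> x' \<in> U"
        by (auto simp: P_def)
      have "x' \<otimes> (inv x' \<otimes> y') = y'"
        using G' by (simp add: m_assoc[symmetric])
      then have "(inv x \<otimes> x') \<otimes> (inv x' \<otimes> y') = inv x \<otimes> y'"
        using G' xG by (simp add: m_assoc)
      then have "inv x \<otimes> y' \<in> B"
        using UU[OF G'(4,3)] G' xG by simp
      moreover have "y' = x \<otimes> (inv x \<otimes> y')"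
        using G' xG by (simp add: m_assoc[symmetric])
      ultimately show "\<exists>z. z \<in> (\<lambda>z. x \<otimes> z) ` B \<and> z \<in> Q"
        using *(3) by blast
    qed
  qed
  then show ?thesis
    using W by blast
qed

text \<open>
  Only the first coordinate moves here, so no halving of \<open>B\<close> is necessary. The relation is
  oriented so that the sets whose density is given are \<open>W \<inter> y B\<close>; its sections \<open>P(x)\<close> are then
  translates of \<open>B\<inverse>\<close>, and they are open by continuity of inversion.
\<close>
lemma (in quasitopological_group) dense_in_translates_if_Delta_h_Baire:
  assumes "Delta_h_Baire T" and B: "openin T B" "\<one> \<in> B"
  shows "\<exists>W. openin T W \<and> W \<noteq> {} \<and> (\<forall>x\<in>W. W \<subseteq> T closure_of ((\<lambda>z. x \<otimes> z) ` B))"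
proof -
  define P where "P = {(x, y). x \<in> carrier G \<and> y \<in> carrier G \<and> inv y \<otimes> x \<in> B}"
  have "semi_neighborhood_diag T P"
    unfolding semi_neighborhood_diag_def
  proof (intro conjI ballI)
    show "P \<subseteq> topspace T \<times> topspace T" by (auto simp: P_def topspace_eq_carrier)
    fix x assume "x \<in> topspace T"
    then have x: "x \<in> carrier G" by (simp add: topspace_eq_carrier)
    have P_section: "P `` {x} = {y \<in> topspace T. inv y \<in> {z \<in> carrier G. z \<otimes> x \<in> B}}"
      using x by (auto simp: P_def topspace_eq_carrier)
    have "openin T (P `` {x})"
      unfolding P_section
      using openin_continuous_map_preimage[OF continuous_inv openin_right_preimage[OF B(1) x]] .
    then show "x \<in> T interior_of (P `` {x})"
      using x B(2) by (simp add: interior_of_openin P_section topspace_eq_carrier)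
  qed
  moreover have "openin T (topspace T)" "topspace T \<noteq> {}"
    using one_closed unfolding topspace_eq_carrier[symmetric] by auto
  ultimately obtain W where W: "openin T W" "W \<noteq> {}"
    and dense: "\<forall>y\<in>W. W \<subseteq> T closure_of {x \<in> W. (x, y) \<in> P}"
    using assms(1) unfolding Delta_h_Baire_def dense_in_def by meson
  have "W \<subseteq> T closure_of ((\<lambda>z. y \<otimes> z) ` B)" if y: "y \<in> W" for y
  proof -
    have "{x \<in> W. (x, y) \<in> P} \<subseteq> (\<lambda>z. y \<otimes> z) ` B"
    proof clarify
      fix x assume "(x, y) \<in> P"
      then have "x \<in> carrier G" "y \<in> carrier G" "inv y \<otimes> x \<in> B"
        by (auto simp: P_def)
      moreover from this have "x = y \<otimes> (inv y \<otimes> x)"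
        by (simp add: m_assoc[symmetric])
      ultimately show "x \<in> (\<lambda>z. y \<otimes> z) ` B" by blast
    qed
    then show ?thesis
      using dense y closure_of_mono by blast
  qed
  then show ?thesis
    using W by blast
qed

theorem theorem8p1:
  fixes G :: "('a, 'b) monoid_scheme" and T :: "'a topology"
  assumes "topologized_group G T"
    and "semiregular_space T"
    and "(Delta_Baire T \<and> paratopological_group G T) \<or>
         (Delta_h_Baire T \<and> quasitopological_group G T)"
  shows "topological_group G T"
  using assms(3)
proof (elim disjE conjE)
  assume *: "Delta_Baire T" "paratopological_group G T"
  show ?thesis
    by (rule semitopological_group.topological_group_if_dense_in_translates
        [OF paratopological_group.semitopological[OF *(2)] assms(2)])
      (rule paratopological_group.dense_in_translates_if_Delta_Baire[OF *(2,1)])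
next
  assume *: "Delta_h_Baire T" "quasitopological_group G T"
  show ?thesis
    by (rule semitopological_group.topological_group_if_dense_in_translates
        [OF quasitopological_group.axioms(1)[OF *(2)] assms(2)])
      (rule quasitopological_group.dense_in_translates_if_Delta_h_Baire[OF *(2,1)])
qed

end
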